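(* If $T$ and $T'$ are trees of respective orders $n$ and $n'$, where $2\le n \leq n'$, then $f(T \,\square\, T') \leq nn'-n+1$. Moreover, the following holds. (i) If $n=n'$, then $f(T \,\square\, T')=nn'-n+1$ if and only if at least one of $T\cong S_n$ and $T'\cong S_{n'}$ holds. (ii) If $n < n'$, then $f(T \,\square\, T')=nn'-n+1$ if and only if $T'\cong S_{n'}$ (and $T$ is arbitrary).
   Context: The order of a graph is its number of vertices. $S_n$ denotes the star $K_{1,n-1}$ on $n$ vertices, and $\cong$ denotes graph isomorphism. The forest number $f(G)$ of a graph $G$ is the maximum number of vertices of a set $X\subseteq V(G)$ such that the induced subgraph $G[X]$ is a forest (contains no cycle). The Cartesian product $G \,\square\, H$ has vertex set $V(G)\times V(H)$, and two vertices $(g,h)$ and $(g',h')$ are adjacent if either $g=g'$ and $hh'\in E(H)$, or $gg'\in E(G)$ and $h=h'$. *)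

theory Defs
  imports "Graph_Theory.Graph_Theory"
begin

text \<open>
  Finite simple graphs are the locale \<^locale>\<open>pair_graph\<close>: finite, loop-free, symmetric
  digraphs whose arcs are ordered pairs, so that an undirected edge is a pair of opposite arcs.

  Under this encoding the library predicate \<^const>\<open>pre_digraph.cycle\<close> also accepts the closed walk
  \<open>a, b, a\<close> along a single edge, hence the library predicates \<^const>\<open>forest\<close> and \<^const>\<open>tree\<close>
  fail for every symmetric digraph with an edge. Requiring length at least 3 leaves exactly
  the cycles of the undirected simple graph.
\<close>

definition undirected_cycle :: "('a, 'b) pre_digraph \<Rightarrow> 'b awalk \<Rightarrow> bool" where
  "undirected_cycle G p \<longleftrightarrow> pre_digraph.cycle G p \<and> 3 \<le> length p"

definition undirected_forest :: "('a, 'b) pre_digraph \<Rightarrow> bool" where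
  "undirected_forest G \<longleftrightarrow> (\<nexists>p. undirected_cycle G p)"

definition undirected_tree :: "'a pair_pre_digraph \<Rightarrow> bool" where
  "undirected_tree T \<longleftrightarrow>
     pair_graph T \<and> connected (with_proj T) \<and> undirected_forest (with_proj T)"

definition order :: "'a pair_pre_digraph \<Rightarrow> nat" where
  "order G = card (pverts G)"

definition forest_number :: "'a pair_pre_digraph \<Rightarrow> nat" where
  "forest_number G =
     Max {card X | X. X \<subseteq> pverts G \<and> undirected_forest (with_proj G \<restriction> X)}"

definition cartesian_product ::
  "'a pair_pre_digraph \<Rightarrow> 'b pair_pre_digraph \<Rightarrow> ('a \<times> 'b) pair_pre_digraph" where
  "cartesian_product G H =
     \<lparr> pverts = pverts G \<times> pverts H,
       parcs = {((g, h), (g', h')) | g h g' h'.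
         (g, h) \<in> pverts G \<times> pverts H \<and> (g', h') \<in> pverts G \<times> pverts H \<and>
         (g = g' \<and> (h, h') \<in> parcs H \<or> (g, g') \<in> parcs G \<and> h = h')} \<rparr>"

definition star :: "nat \<Rightarrow> nat pair_pre_digraph" where
  "star n = \<lparr> pverts = {..<n}, parcs = {0} \<times> {1..<n} \<union> {1..<n} \<times> {0} \<rparr>"

definition isomorphic :: "'a pair_pre_digraph \<Rightarrow> 'b pair_pre_digraph \<Rightarrow> bool" where
  "isomorphic G H \<longleftrightarrow> digraph_iso (with_proj G) (with_proj H)"

lemma star_complete_bipartite:
  assumes "1 \<le> n"
  shows "complete_bipartite_digraph 1 (n - 1) (with_proj (star n))"
proof -
  have "{..<n} = {0} \<union> {1..<n}" using assms by auto
  moreover have "{0} \<inter> {1..<n} = {}" "card {0::nat} = 1" "card {1..<n} = n - 1" by auto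
  ultimately show ?thesis
    unfolding complete_bipartite_digraph_pair_def star_def
    by (intro conjI exI[of _ "{0}"] exI[of _ "{1..<n}"]) simp_all
qed

lemma pair_graph_cartesian_product:
  assumes "pair_graph G" "pair_graph H"
  shows "pair_graph (cartesian_product G H)"
proof -
  interpret G: pair_graph G by fact
  interpret H: pair_graph H by fact
  have fin: "finite (pverts G \<times> pverts H)" by simp
  have "parcs (cartesian_product G H) \<subseteq> (pverts G \<times> pverts H) \<times> (pverts G \<times> pverts H)"
    by (auto simp: cartesian_product_def)
  with fin have "finite (parcs (cartesian_product G H))"
    by (meson finite_SigmaI finite_subset)
  moreover have "symmetric (with_proj (cartesian_product G H))"
    unfolding symmetric_def with_proj_simps
    by (rule symI) (auto simp: cartesian_product_def intro: G.arcs_symmetric H.arcs_symmetric)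
  moreover have "fst e \<noteq> snd e" if "e \<in> parcs (cartesian_product G H)" for e
    using that by (auto simp: cartesian_product_def dest: G.pair_no_loops H.pair_no_loops)
  ultimately show ?thesis using fin
    by unfold_locales (auto simp: cartesian_product_def)
qed

lemma isomorphic_iff:
  assumes "pair_graph G"
  shows "isomorphic G H \<longleftrightarrow>
    (\<exists>f. bij_betw f (pverts G) (pverts H) \<and> parcs H = map_prod f f ` parcs G)"
proof
  interpret G: pair_graph G by fact
  assume "isomorphic G H"
  then obtain m where m: "pre_digraph.digraph_isomorphism (with_proj G) m"
    and H: "with_proj H = app_iso m (with_proj G)"
    by (auto simp: isomorphic_def digraph_iso_def)
  let ?f = "iso_verts m"
  have tl: "iso_tail m = fst" "iso_head m = snd"
    using arg_cong[OF H, of tail] arg_cong[OF H, of head] by simp_all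
  have arcs: "iso_arcs m a = map_prod ?f ?f a" if "a \<in> parcs G" for a
    using m that tl by (simp add: pre_digraph.digraph_isomorphism_def prod_eq_iff)
  have "pverts H = ?f ` pverts G" "parcs H = iso_arcs m ` parcs G"
    using arg_cong[OF H, of verts] arg_cong[OF H, of arcs] by simp_all
  moreover have "inj_on ?f (pverts G)"
    using m by (simp add: pre_digraph.digraph_isomorphism_def)
  ultimately show "\<exists>f. bij_betw f (pverts G) (pverts H) \<and> parcs H = map_prod f f ` parcs G"
    using arcs by (intro exI[of _ ?f]) (simp add: bij_betw_def cong: image_cong)
next
  interpret G: pair_graph G by fact
  assume "\<exists>f. bij_betw f (pverts G) (pverts H) \<and> parcs H = map_prod f f ` parcs G"
  then obtain f where inj: "inj_on f (pverts G)" and v: "pverts H = f ` pverts G"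
    and a: "parcs H = map_prod f f ` parcs G"
    by (auto simp: bij_betw_def)
  let ?m = "\<lparr> iso_verts = f, iso_arcs = map_prod f f, iso_head = snd, iso_tail = fst \<rparr>"
  have "parcs G \<subseteq> pverts G \<times> pverts G"
    using G.in_arcsD1 G.in_arcsD2 by auto
  then have "inj_on (map_prod f f) (parcs G)"
    using map_prod_inj_on[OF inj inj] inj_on_subset by blast
  then have "pre_digraph.digraph_isomorphism (with_proj G) ?m"
    using inj G.wf_digraph by (simp add: pre_digraph.digraph_isomorphism_def)
  moreover have "with_proj H = app_iso ?m (with_proj G)"
    using v a by (simp add: app_iso_def with_proj_def)
  ultimately show "isomorphic G H"
    unfolding isomorphic_def digraph_iso_def by blast
qed

lemma forest_number_attained:
  assumes "finite (pverts G)"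
  shows "\<exists>X \<subseteq> pverts G. undirected_forest (with_proj G \<restriction> X) \<and> card X = forest_number G"
    and "\<And>X. X \<subseteq> pverts G \<Longrightarrow> undirected_forest (with_proj G \<restriction> X) \<Longrightarrow> card X \<le> forest_number G"
proof -
  let ?S = "{card X | X. X \<subseteq> pverts G \<and> undirected_forest (with_proj G \<restriction> X)}"
  have fin: "finite ?S"
    by (rule finite_subset[of _ "card ` Pow (pverts G)"]) (auto simp: assms)
  have "undirected_forest (with_proj G \<restriction> {})"
    by (auto simp: undirected_forest_def undirected_cycle_def pre_digraph.cycle_def
        pre_digraph.awalk_def)
  then have "?S \<noteq> {}" by blast
  from Max_in[OF fin this]
  show "\<exists>X \<subseteq> pverts G. undirected_forest (with_proj G \<restriction> X) \<and> card X = forest_number G"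
    unfolding forest_number_def by auto
  show "card X \<le> forest_number G"
    if "X \<subseteq> pverts G" "undirected_forest (with_proj G \<restriction> X)" for X
    unfolding forest_number_def using that by (intro Max_ge[OF fin]) blast
qed

end

theory Submission
  imports Defs
begin

text \<open>
  Regard the vertices of \<open>T \<box> T'\<close> as an array whose rows \<open>{r} \<times> V(T')\<close> are copies of \<open>T'\<close> and
  whose columns \<open>V(T) \<times> {c}\<close> are copies of \<open>T\<close>. Let \<open>X\<close> induce a forest and let \<open>S\<close> be its
  complement; the claim is about how small \<open>S\<close> can be.

  If \<open>S\<close> missed two rows \<open>r, r'\<close> and two columns \<open>c, c'\<close>, then \<open>X\<close> would contain the perimeter
  of the rectangle spanned by the path from \<open>r\<close> to \<open>r'\<close> in \<open>T\<close> and the path from \<open>c\<close> to \<open>c'\<close>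
  in \<open>T'\<close>, which is a cycle (\<open>rectangle_cycle\<close>). Hence \<open>S\<close> meets all rows but one or all columns
  but one (\<open>forest_misses_almost_all_rows_or_columns\<close>). Both alternatives give
  \<open>card S \<ge> n - 1\<close>, which is the upper bound.

  Suppose that \<open>card S = n - 1\<close> and that \<open>S\<close> meets all rows but one, hence each of these in
  exactly one vertex. Take a row \<open>r\<close> disjoint from \<open>S\<close> and a neighbour \<open>u\<close> of \<open>r\<close> in \<open>T\<close>.
  Every edge \<open>hh'\<close> of \<open>T'\<close> gives a 4-cycle \<open>{r, u} \<times> {h, h'}\<close>, and only the single vertex
  \<open>(u, s)\<close> of \<open>S\<close> in row \<open>u\<close> can lie on it. So \<open>s\<close> is an end of every edge, that is, \<open>T'\<close> is
  a star (\<open>star_of_tight_forest\<close>). If instead \<open>S\<close> meets all columns but one, then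
  \<open>n' - 1 \<le> n - 1\<close>, so \<open>n = n'\<close>, and by symmetry \<open>T\<close> is a star.

  Conversely, let \<open>T'\<close> be a star with centre \<open>c\<close>. Deleting all of column \<open>c\<close> except one vertex
  \<open>(r, c)\<close> leaves the disjoint columns of the leaves, each a tree joined to \<open>(r, c)\<close> by a single
  edge. This is a forest with \<open>n n' - n + 1\<close> vertices (\<open>forest_of_star_center\<close>).
\<close>

section \<open>Cycles as vertex lists\<close>

abbreviation vertex_walk :: "'a rel \<Rightarrow> 'a list \<Rightarrow> bool" where
  "vertex_walk E \<equiv> successively (\<lambda>x y. (x, y) \<in> E)"

text \<open>
  The bound on the length excludes a single edge run through in both directions. The first vertex
  is not repeated at the end of the list, so distinctness is plain \<open>distinct\<close>.
\<close>
definition vertex_cycle :: "'a rel \<Rightarrow> 'a list \<Rightarrow> bool" where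
  "vertex_cycle E xs \<longleftrightarrow> distinct xs \<and> 3 \<le> length xs \<and> vertex_walk E (xs @ [hd xs])"

lemma vertex_walk_rev:
  assumes "sym E"
  shows "vertex_walk E (rev xs) \<longleftrightarrow> vertex_walk E xs"
  unfolding successively_rev
  by (intro iffI; erule successively_mono; use assms in \<open>auto dest: symD\<close>)

lemma vertex_walk_split:
  "vertex_walk E (xs @ x # ys) \<longleftrightarrow> vertex_walk E (xs @ [x]) \<and> vertex_walk E (x # ys)"
  by (auto simp: successively_append_iff)

lemmas vertex_walk_glue = vertex_walk_split [THEN iffD2, OF conjI]

text \<open>A cycle can be entered at any of its vertices.\<close>
lemma vertex_cycle_rotate:
  assumes "vertex_cycle E xs" "z \<in> set xs"
  shows "\<exists>ys. set xs = insert z (set ys) \<and> vertex_cycle E (z # ys)"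
proof -
  obtain as bs where xs: "xs = as @ z # bs"
    using assms(2) by (meson split_list)
  have "vertex_walk E (z # bs @ as @ [z])"
  proof (cases as)
    case Nil
    then show ?thesis using assms(1) xs by (simp add: vertex_cycle_def)
  next
    case (Cons a as')
    then have "vertex_walk E ((a # as') @ z # (bs @ [a]))"
      using assms(1) xs by (simp add: vertex_cycle_def)
    then show ?thesis
      using vertex_walk_split[of E "a # as'" z "bs @ [a]"]
        vertex_walk_split[of E "z # bs" a "as' @ [z]"] Cons by simp
  qed
  then have "vertex_cycle E (z # bs @ as)"
    using assms(1) unfolding xs by (auto simp: vertex_cycle_def)
  then show ?thesis using xs by (intro exI[of _ "bs @ as"]) auto
qed

lemma vertex_cycle_map:
  assumes "vertex_cycle E xs"
    and "\<And>x y. x \<in> set xs \<Longrightarrow> y \<in> set xs \<Longrightarrow> (x, y) \<in> E \<Longrightarrow> (f x, f y) \<in> E'"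
    and "inj_on f (set xs)"
  shows "vertex_cycle E' (map f xs)"
proof -
  have ne: "xs \<noteq> []" using assms(1) by (auto simp: vertex_cycle_def)
  have "vertex_walk E' (map f (xs @ [hd xs]))"
    unfolding successively_map
    by (rule successively_mono[of "\<lambda>x y. (x, y) \<in> E"])
      (use assms(1,2) ne in \<open>auto simp: vertex_cycle_def\<close>)
  then show ?thesis
    using assms(1,3) ne by (auto simp: vertex_cycle_def distinct_map hd_map)
qed

lemma vertex_walk_of_pcas:
  assumes "pcas u p v" "set p \<subseteq> E"
  shows "vertex_walk E (pawalk_verts u p) \<and> hd (pawalk_verts u p) = u \<and> last (pawalk_verts u p) = v"
  using assms
proof (induction p arbitrary: u)
  case (Cons e p)
  then show ?case
    by (cases e; cases p) (auto simp: successively_Cons)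
qed auto

lemma pcas_of_vertex_walk:
  assumes "vertex_walk E xs" "xs \<noteq> []"
  shows "\<exists>p. pcas (hd xs) p (last xs) \<and> set p \<subseteq> E \<and> pawalk_verts (hd xs) p = xs"
  using assms
proof (induction xs rule: induct_list012)
  case (2 x)
  show ?case by (intro exI[of _ "[]"]) simp
next
  case (3 x y zs)
  then obtain p where "pcas y p (last (y # zs))" "set p \<subseteq> E" "pawalk_verts y p = y # zs"
    by auto
  with 3 show ?case by (intro exI[of _ "(x, y) # p"]) auto
qed simp

text \<open>
  Arcs are pairs of vertices here, so a closed walk is determined by its vertices. This equivalence
  turns the forest condition on arc walks into one on vertex lists, which are easier to build from
  pieces and to project to the factors of a product.
\<close>
lemma undirected_cycle_iff_vertex_cycle:
  assumes "pair_wf_digraph G"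
  shows "(\<exists>p. undirected_cycle (with_proj G) p) \<longleftrightarrow> (\<exists>xs. vertex_cycle (parcs G) xs)"
proof
  interpret pair_wf_digraph G by fact
  assume "\<exists>p. undirected_cycle (with_proj G) p"
  then obtain u p where p: "awalk u p u" "distinct (tl (pawalk_verts u p))" "3 \<le> length p"
    by (auto simp: undirected_cycle_def cycle_def)
  let ?w = "pawalk_verts u p"
  have w: "vertex_walk (parcs G) ?w" "hd ?w = u" "last ?w = u"
    using vertex_walk_of_pcas[of u p u "parcs G"] p(1) by (auto simp: awalk_def)
  \<comment> \<open>The vertex list of the closed arc walk has its first vertex repeated at the end.\<close>
  have len: "length ?w = Suc (length p)" by (rule length_awalk_verts)
  then obtain x ys where x: "?w = x # ys" by (cases ?w) auto
  with w p len obtain zs where ys: "ys = zs @ [x]"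
    by (cases ys rule: rev_cases) auto
  have "vertex_cycle (parcs G) (x # zs)"
    using w p len x ys by (auto simp: vertex_cycle_def)
  then show "\<exists>xs. vertex_cycle (parcs G) xs" ..
next
  interpret pair_wf_digraph G by fact
  assume "\<exists>xs. vertex_cycle (parcs G) xs"
  then obtain xs where xs: "vertex_cycle (parcs G) xs" ..
  then obtain x ys where x: "xs = x # ys" by (cases xs) (auto simp: vertex_cycle_def)
  obtain p where p: "pcas x p x" "set p \<subseteq> parcs G" "pawalk_verts x p = xs @ [x]"
    using pcas_of_vertex_walk[of "parcs G" "xs @ [x]"] xs x
    by (auto simp: vertex_cycle_def)
  have len: "length p = length xs"
    using length_awalk_verts[of x p] p(3) by simp
  have "(x, hd ys) \<in> parcs G"
    using xs x by (cases ys) (auto simp: vertex_cycle_def)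
  then have "x \<in> pverts G" by (rule in_arcsD1)
  then have "undirected_cycle (with_proj G) p"
    using p len xs x unfolding undirected_cycle_def cycle_def awalk_def
    by (auto simp: vertex_cycle_def intro!: exI[of _ x])
  then show "\<exists>p. undirected_cycle (with_proj G) p" ..
qed

lemma undirected_forest_iff:
  assumes "pair_graph G"
  shows "undirected_forest (with_proj G) \<longleftrightarrow> (\<nexists>xs. vertex_cycle (parcs G) xs)"
proof -
  interpret pair_graph G by fact
  show ?thesis
    using undirected_cycle_iff_vertex_cycle[OF pair_wf_digraph]
    by (auto simp: undirected_forest_def)
qed

lemma vertex_cycle_arcs_within:
  "vertex_cycle {e \<in> E. fst e \<in> X \<and> snd e \<in> X} xs \<longleftrightarrow> vertex_cycle E xs \<and> set xs \<subseteq> X"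
  (is "vertex_cycle ?F xs \<longleftrightarrow> _")
proof
  assume l: "vertex_cycle ?F xs"
  have "set xs \<subseteq> X"
  proof
    fix z assume "z \<in> set xs"
    then obtain ys where "vertex_cycle ?F (z # ys)"
      using vertex_cycle_rotate[OF l] by blast
    then show "z \<in> X" by (cases ys) (auto simp: vertex_cycle_def)
  qed
  moreover have "vertex_cycle E xs"
    using vertex_cycle_map[OF l, of id E] by auto
  ultimately show "vertex_cycle E xs \<and> set xs \<subseteq> X" by simp
next
  assume "vertex_cycle E xs \<and> set xs \<subseteq> X"
  then show "vertex_cycle ?F xs"
    using vertex_cycle_map[of E xs id ?F] by auto
qed

lemma undirected_forest_induced_iff:
  assumes "pair_graph G"
  shows "undirected_forest (with_proj G \<restriction> X) \<longleftrightarrow>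
    (\<nexists>xs. vertex_cycle (parcs G) xs \<and> set xs \<subseteq> X)"
proof -
  interpret pair_graph G by fact
  let ?H = "\<lparr>pverts = X, parcs = {e \<in> parcs G. fst e \<in> X \<and> snd e \<in> X}\<rparr>"
  have H: "with_proj G \<restriction> X = with_proj ?H"
    by (simp add: induce_subgraph_def with_proj_def)
  have "pair_wf_digraph ?H" by unfold_locales auto
  then show ?thesis
    unfolding undirected_forest_def H
    using undirected_cycle_iff_vertex_cycle[of ?H] by (simp add: vertex_cycle_arcs_within)
qed

section \<open>Trees\<close>

lemma undirected_tree_path:
  assumes "undirected_tree T" "u \<in> pverts T" "v \<in> pverts T"
  shows "\<exists>xs. vertex_walk (parcs T) xs \<and> distinct xs \<and> xs \<noteq> [] \<and> hd xs = u \<and> last xs = v"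
proof -
  interpret pair_graph T using assms(1) by (simp add: undirected_tree_def)
  have "strongly_connected (with_proj T)"
    using symmetric_connected_imp_strongly_connected assms(1) pair_sym_arcs
    by (simp add: undirected_tree_def)
  then have "u \<rightarrow>\<^sup>*\<^bsub>with_proj T\<^esub> v" using assms(2,3) by (auto simp: strongly_connected_def)
  then obtain p where "apath u p v" using reachable_apath by auto
  then show ?thesis
    using vertex_walk_of_pcas[of u p v "parcs T"]
    by (intro exI[of _ "pawalk_verts u p"]) (auto simp: apath_def awalk_def awalk_verts_non_Nil)
qed

lemma (in pair_wf_digraph) vertex_walk_subset_pverts:
  assumes "vertex_walk (parcs G) (u # xs @ [v])"
  shows "set (u # xs @ [v]) \<subseteq> pverts G"
  using assms
  by (induction xs arbitrary: u) (auto dest: in_arcsD1 in_arcsD2)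

lemma undirected_tree_path_between:
  assumes "undirected_tree T" "u \<in> pverts T" "v \<in> pverts T" "u \<noteq> v"
  shows "\<exists>xs. vertex_walk (parcs T) (u # xs @ [v]) \<and> distinct (u # xs @ [v])"
proof -
  obtain ys where ys: "vertex_walk (parcs T) ys" "distinct ys" "ys \<noteq> []" "hd ys = u" "last ys = v"
    using undirected_tree_path[OF assms(1-3)] by blast
  then obtain zs where "ys = u # zs" by (cases ys) auto
  with ys \<open>u \<noteq> v\<close> obtain xs where "ys = u # xs @ [v]"
    by (cases zs rule: rev_cases) auto
  then show ?thesis using ys by blast
qed

lemma undirected_tree_neighbour:
  assumes "undirected_tree T" "2 \<le> card (pverts T)" "u \<in> pverts T"
  shows "\<exists>v. (u, v) \<in> parcs T"
proof -
  have "pverts T \<noteq> {u}" using assms(2) by auto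
  then obtain v where "v \<in> pverts T" "u \<noteq> v" using assms(3) by blast
  then obtain xs where "vertex_walk (parcs T) (u # xs @ [v])"
    using undirected_tree_path_between assms by metis
  then show ?thesis by (cases xs) auto
qed

text \<open>
  This says only that \<open>{c}\<close> is a vertex cover: it is what the 4-cycles of the product yield.
  By \<open>isomorphic_star_iff\<close> below, it characterises stars among trees.
\<close>
definition star_center :: "'a pair_pre_digraph \<Rightarrow> 'a \<Rightarrow> bool" where
  "star_center G c \<longleftrightarrow> c \<in> pverts G \<and> (\<forall>(x, y) \<in> parcs G. x = c \<or> y = c)"

text \<open>
  Connectedness forces all the edges at \<open>c\<close>: the first edge of the path from \<open>v\<close> to \<open>c\<close> must
  contain \<open>c\<close>, and it does not start there.
\<close>
lemma star_center_parcs: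
  assumes "undirected_tree T" "star_center T c"
  shows "parcs T = {c} \<times> (pverts T - {c}) \<union> (pverts T - {c}) \<times> {c}"
proof -
  interpret pair_graph T using assms(1) by (simp add: undirected_tree_def)
  have in_edge: "(v, c) \<in> parcs T" if v: "v \<in> pverts T" "v \<noteq> c" for v
  proof -
    obtain xs where xs: "vertex_walk (parcs T) (v # xs @ [c])" "distinct (v # xs @ [c])"
      using undirected_tree_path_between[OF assms(1), of v c] v assms(2)
      by (auto simp: star_center_def)
    show ?thesis
    proof (cases xs)
      case Nil then show ?thesis using xs by simp
    next
      case (Cons w ws)
      then have "(v, w) \<in> parcs T" "w \<noteq> c" using xs by auto
      then show ?thesis using assms(2) v by (auto simp: star_center_def)
    qed
  qed
  moreover have "parcs T \<subseteq> {c} \<times> (pverts T - {c}) \<union> (pverts T - {c}) \<times> {c}"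
  proof
    fix e assume that: "e \<in> parcs T"
    show "e \<in> {c} \<times> (pverts T - {c}) \<union> (pverts T - {c}) \<times> {c}"
      using that assms(2) arc_fst_in_verts[OF that] arc_snd_in_verts[OF that] pair_no_loops[OF that]
      by (cases e) (auto simp: star_center_def)
  qed
  moreover have "(c, v) \<in> parcs T" if "v \<in> pverts T" "v \<noteq> c" for v
    using in_edge[OF that] by (rule arcs_symmetric)
  ultimately show ?thesis by blast
qed

lemma isomorphic_star_iff:
  assumes "undirected_tree T" "order T = n" "1 \<le> n"
  shows "isomorphic T (star n) \<longleftrightarrow> (\<exists>c. star_center T c)"
proof -
  have T: "pair_graph T" using assms(1) by (simp add: undirected_tree_def)
  interpret pair_graph T by fact
  have iso: "isomorphic T (star n) \<longleftrightarrow>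
    (\<exists>f. bij_betw f (pverts T) {..<n} \<and>
      {0} \<times> {1..<n} \<union> {1..<n} \<times> {0} = map_prod f f ` parcs T)"
    unfolding isomorphic_iff[OF T] by (simp add: star_def)
  show ?thesis unfolding iso
  proof
    assume "\<exists>f. bij_betw f (pverts T) {..<n} \<and>
      {0} \<times> {1..<n} \<union> {1..<n} \<times> {0} = map_prod f f ` parcs T"
    then obtain f where f: "bij_betw f (pverts T) {..<n}"
      and E: "{0} \<times> {1..<n} \<union> {1..<n} \<times> {0} = map_prod f f ` parcs T" by blast
    have "0 \<in> f ` pverts T" using f assms(3) by (simp add: bij_betw_def)
    then obtain c where c: "c \<in> pverts T" "f c = 0" by (metis imageE)
    have "x = c \<or> y = c" if "(x, y) \<in> parcs T" for x y
    proof -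
      have "(f x, f y) \<in> {0} \<times> {1..<n} \<union> {1..<n} \<times> {0}" using that unfolding E by force
      then have "f x = f c \<or> f y = f c" using c by auto
      then show ?thesis
        using f c that in_arcsD1 in_arcsD2 by (meson bij_betw_def inj_onD)
    qed
    then show "\<exists>c. star_center T c" using c by (auto simp: star_center_def)
  next
    assume "\<exists>c. star_center T c"
    then obtain c where c: "star_center T c" ..
    then have cT: "c \<in> pverts T" by (simp add: star_center_def)
    have "card (pverts T - {c}) = card {1..<n}"
      using cT assms(2) by (simp add: order_def)
    then obtain g where g: "bij_betw g (pverts T - {c}) {1..<n}"
      using finite_same_card_bij[of "pverts T - {c}" "{1..<n}"] by auto
    define f where "f = g(c := 0)"
    have f: "bij_betw f (pverts T - {c}) {1..<n}"
      using g by (subst bij_betw_cong[of _ f g]) (auto simp: f_def)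
    have f0: "f c = 0" by (simp add: f_def)
    have "bij_betw f (pverts T - {c} \<union> {c}) ({1..<n} \<union> {f c})"
      using f f0 by (intro notIn_Un_bij_betw) auto
    moreover have "{1..<n} \<union> {f c} = {..<n}" "pverts T - {c} \<union> {c} = pverts T"
      using assms(3) cT f0 by auto
    ultimately have "bij_betw f (pverts T) {..<n}" by simp
    moreover have "{0} \<times> {1..<n} \<union> {1..<n} \<times> {0} = map_prod f f ` parcs T"
      unfolding star_center_parcs[OF assms(1) c] using f f0
      by (simp add: image_Un map_prod_surj_on bij_betw_def flip: image_paired_Times)
    ultimately show "\<exists>f. bij_betw f (pverts T) {..<n} \<and>
      {0} \<times> {1..<n} \<union> {1..<n} \<times> {0} = map_prod f f ` parcs T" by blast
  qed
qed

section \<open>Cartesian products\<close>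

lemma parcs_cartesian_product_iff:
  assumes "pair_wf_digraph G" "pair_wf_digraph H"
  shows "((g, h), (g', h')) \<in> parcs (cartesian_product G H) \<longleftrightarrow>
    g = g' \<and> g \<in> pverts G \<and> (h, h') \<in> parcs H \<or>
    (g, g') \<in> parcs G \<and> h = h' \<and> h \<in> pverts H"
proof -
  interpret G: pair_wf_digraph G by fact
  interpret H: pair_wf_digraph H by fact
  show ?thesis
    by (auto simp: cartesian_product_def dest: G.wellformed' H.wellformed')
qed

lemma pverts_cartesian_product [simp]:
  "pverts (cartesian_product G H) = pverts G \<times> pverts H"
  by (simp add: cartesian_product_def)

text \<open>
  Rows and columns play symmetric parts: statements proved for rows are transferred to columns by
  exchanging the factors.
\<close>
lemma forest_cartesian_product_swap:
  assumes "pair_graph G" "pair_graph H"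
    and "undirected_forest (with_proj (cartesian_product G H) \<restriction> X)"
  shows "undirected_forest (with_proj (cartesian_product H G) \<restriction> prod.swap ` X)"
proof -
  interpret G: pair_graph G by fact
  interpret H: pair_graph H by fact
  have False if xs: "vertex_cycle (parcs (cartesian_product H G)) xs" "set xs \<subseteq> prod.swap ` X" for xs
  proof -
    have "vertex_cycle (parcs (cartesian_product G H)) (map prod.swap xs)"
      using xs(1)
      by (rule vertex_cycle_map)
        (auto simp: parcs_cartesian_product_iff G.pair_wf_digraph H.pair_wf_digraph)
    moreover have "set (map prod.swap xs) \<subseteq> X" using xs(2) by auto
    ultimately show False
      using assms(3) undirected_forest_induced_iff[OF pair_graph_cartesian_product[OF assms(1,2)]]
      by blast
  qed
  then show ?thesis
    using undirected_forest_induced_iff[OF pair_graph_cartesian_product[OF assms(2,1)]] by blast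
qed

text \<open>
  The cycle is the perimeter of the rectangle spanned by the two paths. If both paths are single
  edges, it is a 4-cycle.
\<close>
lemma rectangle_cycle:
  assumes "pair_graph G" "pair_graph H"
    and G_path: "vertex_walk (parcs G) (u # ps @ [v])" "distinct (u # ps @ [v])"
    and H_path: "vertex_walk (parcs H) (a # qs @ [b])" "distinct (a # qs @ [b])"
  shows "\<exists>xs. vertex_cycle (parcs (cartesian_product G H)) xs \<and>
    set xs \<subseteq> {u, v} \<times> set (a # qs @ [b]) \<union> set (u # ps @ [v]) \<times> {a, b}"
proof -
  interpret G: pair_graph G by fact
  interpret H: pair_graph H by fact
  let ?E = "parcs (cartesian_product G H)"
  let ?row = "\<lambda>g. map (Pair g)" and ?col = "\<lambda>h. map (\<lambda>g. (g, h))"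
  note arc_iff = parcs_cartesian_product_iff[OF G.pair_wf_digraph H.pair_wf_digraph]
  have row: "vertex_walk ?E (?row g xs)" if "vertex_walk (parcs H) xs" "g \<in> pverts G" for g xs
    unfolding successively_map using that(1)
    by (rule successively_mono) (use that(2) in \<open>simp_all add: arc_iff\<close>)
  have col: "vertex_walk ?E (?col h xs)" if "vertex_walk (parcs G) xs" "h \<in> pverts H" for h xs
    unfolding successively_map using that(1)
    by (rule successively_mono) (use that(2) in \<open>simp_all add: arc_iff\<close>)
  have uv: "u \<in> pverts G" "v \<in> pverts G"
    using G.vertex_walk_subset_pverts[OF G_path(1)] by auto
  have ab: "a \<in> pverts H" "b \<in> pverts H"
    using H.vertex_walk_subset_pverts[OF H_path(1)] by auto
  have symG: "sym (parcs G)" and symH: "sym (parcs H)"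
    by (auto intro: symI G.arcs_symmetric H.arcs_symmetric)
  have "vertex_walk (parcs G) (v # rev ps @ [u])" "vertex_walk (parcs H) (b # rev qs @ [a])"
    using vertex_walk_rev[OF symG, of "u # ps @ [v]"] G_path(1)
      vertex_walk_rev[OF symH, of "a # qs @ [b]"] H_path(1) by simp_all
  then have sides:
    "vertex_walk ?E (((u, a) # ?row u qs) @ [(u, b)])"
    "vertex_walk ?E (((u, b) # ?col b ps) @ [(v, b)])"
    "vertex_walk ?E (((v, b) # ?row v (rev qs)) @ [(v, a)])"
    "vertex_walk ?E ((v, a) # ?col a (rev ps) @ [(u, a)])"
    using row[OF H_path(1) uv(1)] col[OF G_path(1) ab(2)] row[of "b # rev qs @ [a]" v]
      col[of "v # rev ps @ [u]" a] uv ab by simp_all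
  \<comment> \<open>Once around the rectangle, each corner starting a new side.\<close>
  define xs where "xs = (u, a) # ?row u qs @ (u, b) # ?col b ps @
    (v, b) # ?row v (rev qs) @ (v, a) # ?col a (rev ps)"
  have "vertex_walk ?E ((v, b) # ?row v (rev qs) @ (v, a) # ?col a (rev ps) @ [(u, a)])"
    using vertex_walk_glue[OF sides(3,4)] by simp
  then have "vertex_walk ?E ((u, b) # ?col b ps @ (v, b) # ?row v (rev qs) @
      (v, a) # ?col a (rev ps) @ [(u, a)])"
    using vertex_walk_glue[OF sides(2)] by simp
  then have "vertex_walk ?E (xs @ [hd xs])"
    using vertex_walk_glue[OF sides(1)] by (simp add: xs_def)
  moreover have "distinct xs"
    using G_path(2) H_path(2) by (auto simp: xs_def distinct_map inj_on_def)
  ultimately have "vertex_cycle ?E xs" by (simp add: vertex_cycle_def xs_def)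
  moreover have "set xs \<subseteq> {u, v} \<times> set (a # qs @ [b]) \<union> set (u # ps @ [v]) \<times> {a, b}"
    by (auto simp: xs_def)
  ultimately show ?thesis by blast
qed

section \<open>Forests in a product of two trees\<close>

lemma forest_hits_two_rows_two_columns:
  assumes "undirected_tree T" "undirected_tree T'"
    and "undirected_forest (with_proj (cartesian_product T T') \<restriction> X)"
    and "r \<in> pverts T" "r' \<in> pverts T" "r \<noteq> r'"
    and "c \<in> pverts T'" "c' \<in> pverts T'" "c \<noteq> c'"
  shows "\<not> {r, r'} \<times> pverts T' \<union> pverts T \<times> {c, c'} \<subseteq> X"
proof
  assume sub: "{r, r'} \<times> pverts T' \<union> pverts T \<times> {c, c'} \<subseteq> X"
  have T: "pair_graph T" and T': "pair_graph T'"
    using assms(1,2) by (simp_all add: undirected_tree_def)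
  interpret T: pair_graph T by fact
  interpret T': pair_graph T' by fact
  obtain ps where ps: "vertex_walk (parcs T) (r # ps @ [r'])" "distinct (r # ps @ [r'])"
    using undirected_tree_path_between assms(1,4-6) by metis
  obtain qs where qs: "vertex_walk (parcs T') (c # qs @ [c'])" "distinct (c # qs @ [c'])"
    using undirected_tree_path_between assms(2,7-9) by metis
  obtain xs where "vertex_cycle (parcs (cartesian_product T T')) xs"
    "set xs \<subseteq> {r, r'} \<times> set (c # qs @ [c']) \<union> set (r # ps @ [r']) \<times> {c, c'}"
    using rectangle_cycle[OF T T' ps qs] by blast
  moreover have "set (r # ps @ [r']) \<subseteq> pverts T" "set (c # qs @ [c']) \<subseteq> pverts T'"
    using T.vertex_walk_subset_pverts[OF ps(1)] T'.vertex_walk_subset_pverts[OF qs(1)] .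
  ultimately have "set xs \<subseteq> X" using sub by blast
  then show False
    using \<open>vertex_cycle _ xs\<close> assms(3)
      undirected_forest_induced_iff[OF pair_graph_cartesian_product[OF T T']] by blast
qed

lemma forest_misses_almost_all_rows_or_columns:
  assumes "undirected_tree T" "undirected_tree T'"
    and "undirected_forest (with_proj (cartesian_product T T') \<restriction> X)"
  defines "S \<equiv> pverts T \<times> pverts T' - X"
  shows "card (pverts T) \<le> Suc (card (fst ` S)) \<or> card (pverts T') \<le> Suc (card (snd ` S))"
proof (rule ccontr)
  assume neg: "\<not> ?thesis"
  interpret T: pair_graph T using assms(1) by (simp add: undirected_tree_def)
  interpret T': pair_graph T' using assms(2) by (simp add: undirected_tree_def)
  have two: "\<exists>x y. x \<in> A - B \<and> y \<in> A - B \<and> x \<noteq> y"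
    if "finite A" "B \<subseteq> A" "\<not> card A \<le> Suc (card B)" for A B :: "'c set"
  proof -
    have "\<not> card (A - B) \<le> Suc 0"
      using that by (simp add: card_Diff_subset finite_subset)
    then show ?thesis
      using that(1) by (auto simp: card_le_Suc0_iff_eq)
  qed
  have sub: "fst ` S \<subseteq> pverts T" "snd ` S \<subseteq> pverts T'" by (auto simp: S_def)
  obtain r r' where r: "r \<in> pverts T - fst ` S" "r' \<in> pverts T - fst ` S" "r \<noteq> r'"
    using two[OF T.pair_finite_verts sub(1)] neg by blast
  obtain c c' where c: "c \<in> pverts T' - snd ` S" "c' \<in> pverts T' - snd ` S" "c \<noteq> c'"
    using two[OF T'.pair_finite_verts sub(2)] neg by blast
  have "{r, r'} \<times> pverts T' \<union> pverts T \<times> {c, c'} \<subseteq> X"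
  proof
    fix x assume x: "x \<in> {r, r'} \<times> pverts T' \<union> pverts T \<times> {c, c'}"
    then have "fst x \<in> {r, r'} \<or> snd x \<in> {c, c'}" by auto
    then have "fst x \<notin> fst ` S \<or> snd x \<notin> snd ` S"
      using r(1,2) c(1,2) by (metis DiffD2 emptyE insertE)
    then have "x \<notin> S" by blast
    then show "x \<in> X" using x r(1,2) c(1,2) by (auto simp: S_def)
  qed
  then show False
    using forest_hits_two_rows_two_columns[OF assms(1-3), of r r' c c'] r c by blast
qed

text \<open>
  The hypotheses make \<open>S\<close> have at most one vertex in each row and leave some row \<open>r\<close> untouched.
  Next to an untouched row, the only vertex of \<open>S\<close> in the row \<open>u\<close> must destroy the 4-cycles over
  all edges of \<open>T'\<close> at once.
\<close>
lemma star_of_tight_forest: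
  assumes "undirected_tree T" "undirected_tree T'" "2 \<le> card (pverts T)"
    and "undirected_forest (with_proj (cartesian_product T T') \<restriction> X)"
  defines "S \<equiv> pverts T \<times> pverts T' - X"
  assumes "Suc (card S) = card (pverts T)" "card (pverts T) \<le> Suc (card (fst ` S))"
  shows "\<exists>s. star_center T' s"
proof -
  have T: "pair_graph T" and T': "pair_graph T'"
    using assms(1,2) by (simp_all add: undirected_tree_def)
  interpret T: pair_graph T by fact
  interpret T': pair_graph T' by fact
  have fin: "finite S" by (simp add: S_def T.pair_finite_verts T'.pair_finite_verts)
  have "card (fst ` S) = card S"
    using card_image_le[OF fin, of fst] assms(6,7) by simp
  then have inj: "inj_on fst S" using fin by (simp add: eq_card_imp_inj_on)
  have "\<not> pverts T \<subseteq> fst ` S"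
    using card_mono[of "fst ` S" "pverts T"] fin \<open>card (fst ` S) = card S\<close> assms(6) by auto
  then obtain r where r: "r \<in> pverts T" "r \<notin> fst ` S" by blast
  obtain u where u: "(r, u) \<in> parcs T"
    using undirected_tree_neighbour[OF assms(1,3) r(1)] ..
  have "pverts T' \<noteq> {}"
    using assms(2) by (simp add: undirected_tree_def connected_conv)
  \<comment> \<open>If row \<open>u\<close> has no vertex in \<open>S\<close>, then any vertex of \<open>T'\<close> serves as \<open>s\<close>.\<close>
  then obtain s where s: "s \<in> pverts T'" "\<And>x. (u, x) \<in> S \<Longrightarrow> x = s"
  proof (cases "\<exists>s. (u, s) \<in> S")
    case True
    then obtain s where "(u, s) \<in> S" ..
    moreover from this have "x = s" if "(u, x) \<in> S" for x
      using inj_onD[OF inj _ that, of "(u, s)"] by simp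
    ultimately show ?thesis using that by (auto simp: S_def)
  qed (use that in blast)
  have "h = s \<or> h' = s" if hh': "(h, h') \<in> parcs T'" for h h'
  proof -
    obtain xs where xs: "vertex_cycle (parcs (cartesian_product T T')) xs"
      "set xs \<subseteq> {r, u} \<times> {h, h'}"
      using rectangle_cycle[OF T T', of r "[]" u h "[]" h'] u hh'
        T.no_loops'[OF u] T'.no_loops'[OF hh'] by (simp add: insert_commute) blast
    then have "\<not> set xs \<subseteq> X"
      using assms(4) undirected_forest_induced_iff[OF pair_graph_cartesian_product[OF T T']]
      by blast
    then obtain g k where gk: "(g, k) \<in> {r, u} \<times> {h, h'}" "(g, k) \<notin> X"
      using xs(2) by (meson subrelI subsetD)
    then have "(g, k) \<in> S"
      using r(1) T.in_arcsD2[OF u] T'.in_arcsD1[OF hh'] T'.in_arcsD2[OF hh'] by (auto simp: S_def)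
    then have "g \<in> fst ` S" by (rule rev_image_eqI) simp
    then have "g = u" using gk(1) r(2) by auto
    then have "k = s" using s(2) \<open>(g, k) \<in> S\<close> by blast
    then show ?thesis using gk(1) by auto
  qed
  then show ?thesis using s(1) by (auto simp: star_center_def)
qed

text \<open>
  Away from column \<open>c\<close> no edge joins different columns. So a cycle avoiding \<open>(r, c)\<close> stays in one
  column and projects to a cycle of \<open>T\<close>. A cycle through \<open>(r, c)\<close> leaves it and returns to it
  through the same column, hence through the same vertex, since each column has only one neighbour
  of \<open>(r, c)\<close>.
\<close>
lemma forest_of_star_center:
  assumes "undirected_tree T" "undirected_tree T'" "star_center T' c" "r \<in> pverts T"
  shows "undirected_forest
    (with_proj (cartesian_product T T') \<restriction> insert (r, c) (pverts T \<times> (pverts T' - {c})))"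
    (is "undirected_forest (_ \<restriction> ?X)")
proof -
  have T: "pair_graph T" and T': "pair_graph T'"
    using assms(1,2) by (simp_all add: undirected_tree_def)
  interpret T: pair_graph T by fact
  interpret T': pair_graph T' by fact
  let ?E = "parcs (cartesian_product T T')"
  note arc_iff = parcs_cartesian_product_iff[OF T.pair_wf_digraph T'.pair_wf_digraph]
  have same_column: "\<forall>x \<in> set xs. snd x = snd (hd xs)"
    if "vertex_walk ?E xs" "\<forall>x \<in> set xs. snd x \<noteq> c" for xs
    using that
  proof (induction xs rule: induct_list012)
    case (3 x y zs)
    have "snd x = snd y"
      using 3(3,4) assms(3) by (cases x; cases y) (auto simp: arc_iff star_center_def)
    then show ?case using 3 by auto
  qed auto
  have False if xs: "vertex_cycle ?E xs" "set xs \<subseteq> ?X" for xs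
  proof (cases "(r, c) \<in> set xs")
    case False
    then have "\<forall>x \<in> set xs. snd x \<noteq> c" using xs(2) by auto
    moreover have "vertex_walk ?E xs"
      using xs(1) by (auto simp: vertex_cycle_def successively_append_iff)
    ultimately have col: "\<forall>x \<in> set xs. snd x = snd (hd xs)" by (intro same_column)
    have "vertex_cycle (parcs T) (map fst xs)"
      using xs(1)
    proof (rule vertex_cycle_map)
      show "inj_on fst (set xs)"
        using col by (intro inj_onI prod_eqI) simp_all
      show "(fst x, fst y) \<in> parcs T" if "x \<in> set xs" "y \<in> set xs" "(x, y) \<in> ?E" for x y
      proof -
        have "snd x = snd y" using that(1,2) col by metis
        then show ?thesis
          using that(3) by (cases x; cases y) (auto simp: arc_iff dest: T'.no_loops')
      qed
    qed
    then show False
      using assms(1) undirected_forest_iff[OF T] by (auto simp: undirected_tree_def)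
  next
    case True
    then obtain ys where ys: "set xs = insert (r, c) (set ys)" "vertex_cycle ?E ((r, c) # ys)"
      using vertex_cycle_rotate[OF xs(1)] by blast
    then obtain y zs z where yz: "ys = y # zs @ [z]"
      by (cases ys; cases "tl ys" rule: rev_cases) (auto simp: vertex_cycle_def)
    have walk: "vertex_walk ?E ((r, c) # (y # zs @ [z]) @ [(r, c)])"
      and dist: "distinct ((r, c) # y # zs @ [z])"
      using ys(2) yz by (auto simp: vertex_cycle_def)
    have off: "\<forall>x \<in> set ys. snd x \<noteq> c" using dist xs(2) ys(1) yz by auto
    have ends: "((r, c), y) \<in> ?E" "(z, (r, c)) \<in> ?E"
      and inner: "vertex_walk ?E (y # zs @ [z])"
      using walk successively_append_iff[of _ "y # zs @ [z]" "[(r, c)]"] by simp_all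
    have "snd z = snd y" using same_column[OF inner] off yz by simp
    moreover have "fst y = r" "fst z = r"
      using ends off yz by (cases y; cases z; auto simp: arc_iff)+
    ultimately show False using dist by (auto simp: prod_eq_iff)
  qed
  then show ?thesis
    using undirected_forest_induced_iff[OF pair_graph_cartesian_product[OF T T']] by blast
qed

lemma forest_number_ge_of_star_center:
  assumes "undirected_tree T" "undirected_tree T'" "star_center T' c"
  shows "order T * order T' - order T + 1 \<le> forest_number (cartesian_product T T')"
proof -
  interpret T: pair_graph T using assms(1) by (simp add: undirected_tree_def)
  interpret T': pair_graph T' using assms(2) by (simp add: undirected_tree_def)
  have c: "c \<in> pverts T'" using assms(3) by (simp add: star_center_def)
  have "pverts T \<noteq> {}"
    using assms(1) by (simp add: undirected_tree_def connected_conv)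
  then obtain r where r: "r \<in> pverts T" by blast
  let ?X = "insert (r, c) (pverts T \<times> (pverts T' - {c}))"
  have "card ?X = order T * order T' - order T + 1"
    using c by (simp add: order_def card_cartesian_product T.pair_finite_verts
        T'.pair_finite_verts diff_mult_distrib2)
  moreover have "card ?X \<le> forest_number (cartesian_product T T')"
    using c r forest_of_star_center[OF assms r]
    by (intro forest_number_attained(2)) (auto simp: T.pair_finite_verts T'.pair_finite_verts)
  ultimately show ?thesis by simp
qed

lemma forest_number_cartesian_product_commute:
  assumes "pair_graph G" "pair_graph H"
  shows "forest_number (cartesian_product G H) = forest_number (cartesian_product H G)"
proof -
  have le: "forest_number (cartesian_product A B) \<le> forest_number (cartesian_product B A)"
    if "pair_graph A" "pair_graph B" for A :: "'c pair_pre_digraph" and B :: "'d pair_pre_digraph"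
  proof -
    interpret A: pair_graph A by fact
    interpret B: pair_graph B by fact
    have fin: "finite (pverts (cartesian_product A B))" "finite (pverts (cartesian_product B A))"
      by (simp_all add: A.pair_finite_verts B.pair_finite_verts)
    obtain X where X: "X \<subseteq> pverts (cartesian_product A B)"
      "undirected_forest (with_proj (cartesian_product A B) \<restriction> X)"
      "card X = forest_number (cartesian_product A B)"
      using forest_number_attained(1)[OF fin(1)] by blast
    have "card X = card (prod.swap ` X)" by (simp add: card_image)
    also have "\<dots> \<le> forest_number (cartesian_product B A)"
      using forest_cartesian_product_swap[OF that X(2)] X(1)
      by (intro forest_number_attained(2)[OF fin(2)]) auto
    finally show ?thesis using X(3) by simp
  qed
  show ?thesis using le[OF assms] le[OF assms(2,1)] by simp
qed

text \<open>
  Of the two alternatives for \<open>S\<close>, meeting almost all columns costs at least \<open>order T' - 1\<close>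
  vertices. This is no cheaper than meeting almost all rows, and equally cheap only if the orders
  agree.
\<close>
lemma forest_number_product_of_trees:
  assumes "undirected_tree T" "undirected_tree T'"
    and "2 \<le> order T" "order T \<le> order T'"
  shows "forest_number (cartesian_product T T') \<le> order T * order T' - order T + 1"
    and "forest_number (cartesian_product T T') = order T * order T' - order T + 1 \<Longrightarrow>
      (\<exists>s. star_center T' s) \<or> order T = order T' \<and> (\<exists>s. star_center T s)"
proof -
  have T: "pair_graph T" and T': "pair_graph T'"
    using assms(1,2) by (simp_all add: undirected_tree_def)
  interpret T: pair_graph T by fact
  interpret T': pair_graph T' by fact
  let ?V = "pverts T \<times> pverts T'"
  have fin: "finite ?V" by (simp add: T.pair_finite_verts T'.pair_finite_verts)
  obtain X where X: "X \<subseteq> ?V" "undirected_forest (with_proj (cartesian_product T T') \<restriction> X)"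
    "card X = forest_number (cartesian_product T T')"
    using forest_number_attained(1)[of "cartesian_product T T'"] fin by auto
  define S where "S = ?V - X"
  have finS: "finite S" using fin by (simp add: S_def)
  have card_S: "card X + card S = order T * order T'"
    using card_Diff_subset[OF finite_subset[OF X(1) fin] X(1)] card_mono[OF fin X(1)]
    by (simp add: S_def order_def card_cartesian_product)
  have images: "card (fst ` S) \<le> card S" "card (snd ` S) \<le> card S"
    by (rule card_image_le[OF finS])+
  have lines: "order T \<le> Suc (card (fst ` S)) \<or> order T' \<le> Suc (card (snd ` S))"
    using forest_misses_almost_all_rows_or_columns[OF assms(1,2) X(2)]
    by (simp add: S_def order_def)
  then have S_ge: "order T \<le> Suc (card S)" using images assms(4) by linarith
  have prod_ge: "order T \<le> order T * order T'" using assms(3,4) by simp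
  show "forest_number (cartesian_product T T') \<le> order T * order T' - order T + 1"
    using S_ge card_S prod_ge X(3) by linarith
  assume "forest_number (cartesian_product T T') = order T * order T' - order T + 1"
  then have S_eq: "Suc (card S) = order T" using card_S prod_ge X(3) by linarith
  from lines show "(\<exists>s. star_center T' s) \<or> order T = order T' \<and> (\<exists>s. star_center T s)"
  proof
    assume "order T \<le> Suc (card (fst ` S))"
    then have "\<exists>s. star_center T' s"
      using star_of_tight_forest[OF assms(1,2) _ X(2)] assms(3) S_eq
      by (simp add: S_def order_def)
    then show ?thesis ..
  next
    assume snd: "order T' \<le> Suc (card (snd ` S))"
    then have eq: "order T' = order T" using images S_eq assms(4) by linarith
    have swap_S: "pverts T' \<times> pverts T - prod.swap ` X = prod.swap ` S"
      by (force simp: S_def)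
    have "fst ` prod.swap ` S = snd ` S" "card (prod.swap ` S) = card S"
      by (simp_all add: image_image card_image)
    then have "\<exists>s. star_center T s"
      using star_of_tight_forest[OF assms(2,1) _ forest_cartesian_product_swap[OF T T' X(2)]]
        assms(3) S_eq snd eq unfolding swap_S by (simp add: order_def)
    then show ?thesis using eq by simp
  qed
qed

theorem corollary3p4:
  fixes T :: "'a pair_pre_digraph" and T' :: "'b pair_pre_digraph" and n n' :: nat
  assumes "undirected_tree T" and "undirected_tree T'"
    and "order T = n" and "order T' = n'"
    and "2 \<le> n" and "n \<le> n'"
  shows "forest_number (cartesian_product T T') \<le> n * n' - n + 1 \<and>
    (n = n' \<longrightarrow>
      (forest_number (cartesian_product T T') = n * n' - n + 1 \<longleftrightarrow>
        isomorphic T (star n) \<or> isomorphic T' (star n'))) \<and>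
    (n < n' \<longrightarrow>
      (forest_number (cartesian_product T T') = n * n' - n + 1 \<longleftrightarrow>
        isomorphic T' (star n')))"
proof -
  let ?f = "forest_number (cartesian_product T T')"
  have T: "pair_graph T" and T': "pair_graph T'"
    using assms(1,2) by (simp_all add: undirected_tree_def)
  have star: "isomorphic T (star n) \<longleftrightarrow> (\<exists>s. star_center T s)"
    "isomorphic T' (star n') \<longleftrightarrow> (\<exists>s. star_center T' s)"
    using isomorphic_star_iff[OF assms(1,3)] isomorphic_star_iff[OF assms(2,4)] assms(5,6)
    by simp_all
  have upper: "?f \<le> n * n' - n + 1"
    and tight: "?f = n * n' - n + 1 \<Longrightarrow>
      (\<exists>s. star_center T' s) \<or> n = n' \<and> (\<exists>s. star_center T s)"
    using forest_number_product_of_trees[OF assms(1,2)] assms(3-6) by auto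
  have lower': "n * n' - n + 1 \<le> ?f" if "star_center T' s" for s
    using forest_number_ge_of_star_center[OF assms(1,2) that] assms(3,4) by simp
  have lower: "n * n' - n + 1 \<le> ?f" if "star_center T s" "n = n'" for s
    using forest_number_ge_of_star_center[OF assms(2,1) that(1)] assms(3,4) that(2)
      forest_number_cartesian_product_commute[OF T T'] by simp
  show ?thesis
    unfolding star using upper tight lower lower' by (auto intro: le_antisym)
qed

end
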